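(* Let $1\le i\le k$ and let $\alpha_{i,n}$ be an arbitrary positive real number. The cdf $H_{H,n,\theta,\sigma}^i$ of $\sigma^{-1}\alpha_{i,n}(\hat\theta_{H,i}-\theta_i)$ under $P_{n,\theta,\sigma}$ is given by $$H_{H,n,\theta,\sigma}^i(x)=\Phi\left(n^{1/2}x/(\alpha_{i,n}\xi_{i,n})\right)\mathbf{1}\left(|\alpha_{i,n}^{-1}x+\theta_i/\sigma|>\xi_{i,n}\eta_{i,n}\right)$$ $$+\,\Phi\left(n^{1/2}(-\theta_i/(\sigma\xi_{i,n})+\eta_{i,n})\right)\mathbf{1}\left(0\le\alpha_{i,n}^{-1}x+\theta_i/\sigma\le\xi_{i,n}\eta_{i,n}\right)$$ $$+\,\Phi\left(n^{1/2}(-\theta_i/(\sigma\xi_{i,n})-\eta_{i,n})\right)\mathbf{1}\left(-\xi_{i,n}\eta_{i,n}\le\alpha_{i,n}^{-1}x+\theta_i/\sigma<0\right),$$ or, equivalently, the corresponding measure is $$dH_{H,n,\theta,\sigma}^i(x)=\left\{\Phi\left(n^{1/2}(-\theta_i/(\sigma\xi_{i,n})+\eta_{i,n})\right)-\Phi\left(n^{1/2}(-\theta_i/(\sigma\xi_{i,n})-\eta_{i,n})\right)\right\}d\delta_{-\alpha_{i,n}\theta_i/\sigma}(x)$$ $$+\left(n^{1/2}/(\alpha_{i,n}\xi_{i,n})\right)\phi\left(n^{1/2}x/(\alpha_{i,n}\xi_{i,n})\right)\mathbf{1}\left(|\alpha_{i,n}^{-1}x+\theta_i/\sigma|>\xi_{i,n}\eta_{i,n}\right)dx,$$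 where $\delta_z$ denotes pointmass at $z$.
   Context: Consider the linear regression model $Y=X\theta+u$, where $X$ is a nonstochastic $n\times k$ matrix of rank $k\ge1$ ($n\ge k$), $\theta\in\mathbb{R}^k$, $u\sim N(0,\sigma^2I_n)$, $0<\sigma<\infty$; $P_{n,\theta,\sigma}$ denotes probability under parameters $\theta,\sigma$. $X'$ is the transpose of $X$. $\xi_{i,n}$ is the nonnegative square root of the $i$-th diagonal element of $(X'X/n)^{-1}$. $\hat\theta_{LS}=(X'X)^{-1}X'Y$ with $i$-th component $\hat\theta_{LS,i}$. The tuning parameter $\eta_{i,n}$ is a positive real number. The infeasible (known-variance) hard-thresholding estimator is $\hat\theta_{H,i}=\hat\theta_{LS,i}\mathbf{1}(|\hat\theta_{LS,i}|>\sigma\xi_{i,n}\eta_{i,n})$. $\Phi,\phi$ are the standard normal cdf and pdf. *)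

theory Defs
  imports "HOL-Probability.Probability"
begin

(* The normal distribution N(\<mu>, \<Sigma>) on R^n for positive definite \<Sigma>,
   given by its density with respect to Lebesgue measure. *)
definition multi_normal_density :: "real^'n \<Rightarrow> real^'n^'n \<Rightarrow> real^'n \<Rightarrow> real" where
  "multi_normal_density \<mu> \<Sigma> y =
     exp (- ((y - \<mu>) \<bullet> (matrix_inv \<Sigma> *v (y - \<mu>))) / 2) / sqrt ((2 * pi) ^ CARD('n) * det \<Sigma>)"

abbreviation std_normal_cdf :: "real \<Rightarrow> real" where
  "std_normal_cdf \<equiv> cdf std_normal_distribution"

definition xi :: "real^'k^'n \<Rightarrow> 'k \<Rightarrow> real" where
  "xi X i = sqrt (matrix_inv ((1 / real CARD('n)) *\<^sub>R (transpose X ** X)) $ i $ i)"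

definition theta_LS :: "real^'k^'n \<Rightarrow> real^'n \<Rightarrow> real^'k" where
  "theta_LS X y = matrix_inv (transpose X ** X) *v (transpose X *v y)"

(* The infeasible hard-thresholding estimator of the i-th component: \<sigma> is known,
   \<eta> is the tuning parameter belonging to that component, y is the observed sample. *)
definition theta_H :: "real^'k^'n \<Rightarrow> real \<Rightarrow> real \<Rightarrow> 'k \<Rightarrow> real^'n \<Rightarrow> real" where
  "theta_H X \<sigma> \<eta> i y =
     theta_LS X y $ i * of_bool (\<bar>theta_LS X y $ i\<bar> > \<sigma> * xi X i * \<eta>)"

end

theory Submission
  imports Defs
begin

text \<open>
  Since \<^term>\<open>\<sigma>\<close> is known, the whole problem is one-dimensional. The \<^term>\<open>i\<close>-th least squares
  component is \<^term>\<open>\<theta> $ i + a \<bullet> u\<close> for a fixed vector \<^term>\<open>a\<close> with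
  \<open>xi X i = sqrt n * norm a\<close> (lemmas \<open>theta_LS_linear_model\<close> and \<open>xi_eq_norm_LS_weights\<close>). As
  \<^term>\<open>u\<close> has independent centred normal coordinates of variance \<open>\<sigma>\<^sup>2\<close>, the scaled error
  \<open>W = (\<alpha> / \<sigma>) * (a \<bullet> u)\<close> is centred normal with standard deviation
  \<open>c = \<alpha> * xi X i / sqrt n\<close> (lemma \<open>normal_inner\<close>).

  Hard thresholding sets the estimator to zero when the least squares component is small; in the
  coordinate of the scaled error this moves every point of the interval of radius
  \<open>t = \<alpha> * xi X i * \<eta>\<close> around \<open>z = - \<alpha> * \<theta> $ i / \<sigma>\<close> to the centre \<^term>\<open>z\<close> and leaves all other
  points alone. So the law in question is that of \<open>collapse z t W\<close>. Its distribution function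
  agrees with that of \<^term>\<open>W\<close> outside the interval; inside, it is constant on either side of
  \<^term>\<open>z\<close>, with the value of the normal distribution function at the left end point before
  \<^term>\<open>z\<close> and at the right end point from \<^term>\<open>z\<close> on. The jump at \<^term>\<open>z\<close> is the mass of the
  interval, and the rest of the law keeps its normal density
  (lemmas \<open>cdf_collapse_normal\<close> and \<open>emeasure_collapse_normal\<close>).
\<close>

section \<open>Linear functionals of Gaussian vectors with independent coordinates\<close>

text \<open>
  Lebesgue measure on a Euclidean space is the product of its one-dimensional copies, so for a
  product density the integral over a box factors. Both the marginal laws and the independence of
  the coordinates are read off from this identity.
\<close>

lemma (in prob_space) emeasure_inner_Basis_product_density:
  fixes u :: "'a \<Rightarrow> 'b::euclidean_space" and g :: "'b \<Rightarrow> real \<Rightarrow> ennreal"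
  assumes u: "distributed M lborel u (\<lambda>y. \<Prod>b\<in>Basis. g b (y \<bullet> b))"
    and g [measurable]: "\<And>b. b \<in> Basis \<Longrightarrow> g b \<in> borel_measurable borel"
    and A [measurable]: "\<And>b. b \<in> Basis \<Longrightarrow> A b \<in> sets borel"
  shows "emeasure M {\<omega> \<in> space M. \<forall>b\<in>Basis. u \<omega> \<bullet> b \<in> A b}
       = (\<Prod>b\<in>Basis. \<integral>\<^sup>+x. g b x * indicator (A b) x \<partial>lborel)"
proof -
  define B where "B = {y::'b. \<forall>b\<in>Basis. y \<bullet> b \<in> A b}"
  have B: "B \<in> sets lborel"
    unfolding B_def by measurable
  have ind: "indicator B y = (\<Prod>b\<in>Basis. indicator (A b) (y \<bullet> b) :: ennreal)" for y
    by (cases "y \<in> B") (auto simp: B_def indicator_def intro!: prod_zero)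
  have "{\<omega> \<in> space M. \<forall>b\<in>Basis. u \<omega> \<bullet> b \<in> A b} = u -` B \<inter> space M"
    by (auto simp: B_def)
  then have "emeasure M {\<omega> \<in> space M. \<forall>b\<in>Basis. u \<omega> \<bullet> b \<in> A b}
      = (\<integral>\<^sup>+y. (\<Prod>b\<in>Basis. g b (y \<bullet> b)) * indicator B y \<partial>lborel)"
    using distributed_emeasure[OF u B] by simp
  also have "\<dots> = (\<integral>\<^sup>+y. (\<Prod>b\<in>Basis. g b (y \<bullet> b) * indicator (A b) (y \<bullet> b)) \<partial>lborel)"
    by (simp add: ind prod.distrib)
  also have "\<dots> = (\<Prod>b\<in>Basis. \<integral>\<^sup>+x. g b x * indicator (A b) x \<partial>lborel)"
    by (rule nn_integral_lborel_prod) auto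
  finally show ?thesis .
qed

lemma (in prob_space) distributed_inner_Basis:
  fixes u :: "'a \<Rightarrow> 'b::euclidean_space" and g :: "'b \<Rightarrow> real \<Rightarrow> ennreal"
  assumes u: "distributed M lborel u (\<lambda>y. \<Prod>b\<in>Basis. g b (y \<bullet> b))"
    and g [measurable]: "\<And>b. b \<in> Basis \<Longrightarrow> g b \<in> borel_measurable borel"
    and int1: "\<And>b. b \<in> Basis \<Longrightarrow> (\<integral>\<^sup>+x. g b x \<partial>lborel) = 1"
    and b: "b \<in> Basis"
  shows "distributed M lborel (\<lambda>\<omega>. u \<omega> \<bullet> b) (g b)"
proof -
  have [measurable]: "u \<in> borel_measurable M"
    using u by (simp add: distributed_def)
  have "distr M lborel (\<lambda>\<omega>. u \<omega> \<bullet> b) = density lborel (g b)"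
  proof (rule measure_eqI)
    fix A assume "A \<in> sets (distr M lborel (\<lambda>\<omega>. u \<omega> \<bullet> b))"
    then have A [measurable]: "A \<in> sets borel" by simp
    \<comment> \<open>A box that constrains only coordinate \<^term>\<open>b\<close>: all other factors integrate to one.\<close>
    define A' where "A' b' = (if b' = b then A else UNIV)" for b'
    have A': "A' b' \<in> sets borel" for b' by (simp add: A'_def)
    have "(\<lambda>\<omega>. u \<omega> \<bullet> b) -` A \<inter> space M = {\<omega> \<in> space M. \<forall>b\<in>Basis. u \<omega> \<bullet> b \<in> A' b}"
      using b by (auto simp: A'_def)
    then have "emeasure (distr M lborel (\<lambda>\<omega>. u \<omega> \<bullet> b)) A
        = (\<Prod>b\<in>Basis. \<integral>\<^sup>+x. g b x * indicator (A' b) x \<partial>lborel)"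
      using emeasure_inner_Basis_product_density[OF u g A']
      by (simp add: emeasure_distr)
    also have "\<dots> = (\<Prod>b'\<in>Basis. if b' = b then \<integral>\<^sup>+x. g b x * indicator A x \<partial>lborel else 1)"
      by (rule prod.cong) (auto simp: A'_def int1)
    also have "\<dots> = emeasure (density lborel (g b)) A"
      using b by (simp add: emeasure_density)
    finally show "emeasure (distr M lborel (\<lambda>\<omega>. u \<omega> \<bullet> b)) A = emeasure (density lborel (g b)) A" .
  qed simp
  then show ?thesis
    using b by (simp add: distributed_def)
qed

lemma (in prob_space) indep_vars_inner_Basis:
  fixes u :: "'a \<Rightarrow> 'b::euclidean_space" and g :: "'b \<Rightarrow> real \<Rightarrow> ennreal"
  assumes u: "distributed M lborel u (\<lambda>y. \<Prod>b\<in>Basis. g b (y \<bullet> b))"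
    and g [measurable]: "\<And>b. b \<in> Basis \<Longrightarrow> g b \<in> borel_measurable borel"
    and int1: "\<And>b. b \<in> Basis \<Longrightarrow> (\<integral>\<^sup>+x. g b x \<partial>lborel) = 1"
  shows "indep_vars (\<lambda>_. borel) (\<lambda>b \<omega>. u \<omega> \<bullet> b) Basis"
proof -
  have [measurable]: "u \<in> borel_measurable M"
    using u by (simp add: distributed_def)
  have "prob (\<Inter>b\<in>Basis. (\<lambda>\<omega>. u \<omega> \<bullet> b) -` A b \<inter> space M)
      = (\<Prod>b\<in>Basis. prob ((\<lambda>\<omega>. u \<omega> \<bullet> b) -` A b \<inter> space M))"
    if "A \<in> (\<Pi> b\<in>Basis. sets borel)" for A
  proof -
    have A: "\<And>b. b \<in> Basis \<Longrightarrow> A b \<in> sets borel" using that by auto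
    have eq: "(\<Inter>b\<in>Basis. (\<lambda>\<omega>. u \<omega> \<bullet> b) -` A b \<inter> space M)
        = {\<omega> \<in> space M. \<forall>b\<in>Basis. u \<omega> \<bullet> b \<in> A b}"
      using SOME_Basis by auto
    have "emeasure M (\<Inter>b\<in>Basis. (\<lambda>\<omega>. u \<omega> \<bullet> b) -` A b \<inter> space M)
        = (\<Prod>b\<in>Basis. \<integral>\<^sup>+x. g b x * indicator (A b) x \<partial>lborel)"
      unfolding eq by (rule emeasure_inner_Basis_product_density[OF u]) (use g A in auto)
    also have "\<dots> = (\<Prod>b\<in>Basis. emeasure M ((\<lambda>\<omega>. u \<omega> \<bullet> b) -` A b \<inter> space M))"
    proof (rule prod.cong[OF refl])
      fix b :: 'b assume b: "b \<in> Basis"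
      have "distributed M lborel (\<lambda>\<omega>. u \<omega> \<bullet> b) (g b)"
        by (rule distributed_inner_Basis[OF u g int1 b])
      from distributed_emeasure[OF this, of "A b"] A[OF b]
      show "(\<integral>\<^sup>+x. g b x * indicator (A b) x \<partial>lborel) = emeasure M ((\<lambda>\<omega>. u \<omega> \<bullet> b) -` A b \<inter> space M)"
        by simp
    qed
    finally show ?thesis
      by (simp add: emeasure_eq_measure prod_ennreal prod_nonneg)
  qed
  then show ?thesis
    by (subst indep_vars_finite[where E = "\<lambda>_. sets borel"])
       (auto simp: Int_stable_def sets.sigma_sets_eq[of borel, simplified])
qed

text \<open>
  The inner product is a sum of independent normal variables, whose variances add up to
  \<open>\<sigma>\<^sup>2 * (norm a)\<^sup>2\<close>.
\<close>

lemma (in prob_space) normal_inner: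
  fixes u :: "'a \<Rightarrow> 'b::euclidean_space"
  assumes \<sigma>: "0 < \<sigma>" and a: "a \<noteq> 0"
    and u: "distributed M lborel u (\<lambda>y. ennreal (\<Prod>b\<in>Basis. normal_density 0 \<sigma> (y \<bullet> b)))"
  shows "distributed M lborel (\<lambda>\<omega>. a \<bullet> u \<omega>) (normal_density 0 (\<sigma> * norm a))"
proof -
  have u': "distributed M lborel u (\<lambda>y. \<Prod>b\<in>Basis. ennreal (normal_density 0 \<sigma> (y \<bullet> b)))"
    using u by (simp add: prod_ennreal normal_density_nonneg)
  have g: "(\<lambda>x. ennreal (normal_density 0 \<sigma> x)) \<in> borel_measurable borel"
    by measurable
  have int1: "(\<integral>\<^sup>+x. ennreal (normal_density 0 \<sigma> x) \<partial>lborel) = 1"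
    using prob_space.emeasure_space_1[OF prob_space_normal_density[OF \<sigma>, of 0]]
    by (simp add: emeasure_density)
  \<comment> \<open>A coordinate with zero weight contributes a constant, which has no normal density; only the
      others enter the sum.\<close>
  define J where "J = {b \<in> Basis. a \<bullet> b \<noteq> 0}"
  have J: "finite J" "J \<noteq> {}" "J \<subseteq> Basis"
    using a euclidean_all_zero_iff[of a] by (auto simp: J_def)
  have "indep_vars (\<lambda>_. borel) (\<lambda>b \<omega>. u \<omega> \<bullet> b) J"
    using indep_vars_subset[OF indep_vars_inner_Basis[OF u' g int1] J(3)] .
  then have indep: "indep_vars (\<lambda>_. borel) (\<lambda>b \<omega>. (a \<bullet> b) * (u \<omega> \<bullet> b)) J"
    by (rule indep_vars_compose2) auto
  have normal: "distributed M lborel (\<lambda>\<omega>. (a \<bullet> b) * (u \<omega> \<bullet> b)) (normal_density 0 (\<bar>a \<bullet> b\<bar> * \<sigma>))"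
    if "b \<in> J" for b
    using normal_density_affine[OF distributed_inner_Basis[OF u' g int1] \<sigma>, of b "a \<bullet> b" 0] that
    by (simp add: J_def)
  have "distributed M lborel (\<lambda>\<omega>. \<Sum>b\<in>J. (a \<bullet> b) * (u \<omega> \<bullet> b))
      (normal_density (\<Sum>b\<in>J. 0) (sqrt (\<Sum>b\<in>J. (\<bar>a \<bullet> b\<bar> * \<sigma>)\<^sup>2)))"
    by (rule sum_indep_normal[OF J(1,2) indep _ normal]) (auto simp: J_def \<sigma>)
  moreover have "(\<Sum>b\<in>J. (a \<bullet> b) * (u \<omega> \<bullet> b)) = a \<bullet> u \<omega>" for \<omega>
    unfolding euclidean_inner[of a "u \<omega>"] J_def by (rule sum.mono_neutral_left) auto
  moreover have "(\<Sum>b\<in>J. (\<bar>a \<bullet> b\<bar> * \<sigma>)\<^sup>2) = (\<sigma> * norm a)\<^sup>2"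
  proof -
    have "(\<Sum>b\<in>J. (\<bar>a \<bullet> b\<bar> * \<sigma>)\<^sup>2) = (\<Sum>b\<in>Basis. \<sigma>\<^sup>2 * ((a \<bullet> b) * (a \<bullet> b)))"
      unfolding J_def by (rule sum.mono_neutral_cong_left) (auto simp: power2_eq_square)
    then show ?thesis
      by (simp add: sum_distrib_left[symmetric] euclidean_inner[of a a, symmetric]
          power_mult_distrib power2_norm_eq_inner)
  qed
  ultimately show ?thesis
    using \<sigma> by simp
qed

section \<open>The least squares estimator as a linear functional of the errors\<close>

lemma matrix_inv_eqI:
  fixes A :: "real^'n^'n"
  assumes "A ** B = mat 1"
  shows "matrix_inv A = B"
proof -
  have BA: "B ** A = mat 1"
    using assms by (simp add: matrix_left_right_inverse)
  have "A ** matrix_inv A = mat 1 \<and> matrix_inv A ** A = mat 1"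
    unfolding matrix_inv_def by (rule someI[of _ B]) (use assms BA in auto)
  then show ?thesis
    using BA by (metis matrix_mul_assoc matrix_mul_lid matrix_mul_rid)
qed

lemma matrix_inv_scaleR:
  fixes A :: "real^'n^'n"
  assumes "A ** B = mat 1" "c \<noteq> 0"
  shows "matrix_inv (c *\<^sub>R A) = inverse c *\<^sub>R B"
  by (rule matrix_inv_eqI)
     (use assms in \<open>simp add: scalar_matrix_assoc[symmetric] matrix_scalar_ac\<close>)

text \<open>
  A scalar covariance matrix turns the quadratic form into a sum over the coordinates, which makes
  the multivariate density a product.
\<close>

lemma multi_normal_density_isotropic:
  fixes y :: "real^'n"
  assumes "0 < \<sigma>"
  shows "multi_normal_density 0 (\<sigma>\<^sup>2 *\<^sub>R mat 1) y = (\<Prod>b\<in>Basis. normal_density 0 \<sigma> (y \<bullet> b))"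
proof -
  have inv: "matrix_inv (\<sigma>\<^sup>2 *\<^sub>R mat 1 :: real^'n^'n) = inverse (\<sigma>\<^sup>2) *\<^sub>R mat 1"
    by (rule matrix_inv_scaleR) (use assms in auto)
  have "\<sigma>\<^sup>2 *\<^sub>R mat 1 = (matrix ((*\<^sub>R) (\<sigma>\<^sup>2)) :: real^'n^'n)"
    by (simp add: matrix_scaleR mat_def vec_eq_iff)
  then have det: "det (\<sigma>\<^sup>2 *\<^sub>R mat 1 :: real^'n^'n) = (\<sigma>\<^sup>2) ^ CARD('n)"
    by (simp only: det_matrix_scaleR)
  have "(\<Prod>b\<in>Basis. normal_density 0 \<sigma> (y \<bullet> b))
      = (\<Prod>b\<in>(Basis :: (real^'n) set). 1 / sqrt (2 * pi * \<sigma>\<^sup>2)) * (\<Prod>b\<in>Basis. exp (- (y \<bullet> b)\<^sup>2 / (2 * \<sigma>\<^sup>2)))"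
    unfolding normal_density_def prod.distrib by simp
  also have "(\<Prod>b\<in>Basis. exp (- (y \<bullet> b)\<^sup>2 / (2 * \<sigma>\<^sup>2))) = exp (- (y \<bullet> y) / (2 * \<sigma>\<^sup>2))"
    by (simp add: exp_sum[symmetric] sum_divide_distrib[symmetric] sum_negf euclidean_inner[of y y] power2_eq_square)
  also have "(\<Prod>b\<in>(Basis :: (real^'n) set). 1 / sqrt (2 * pi * \<sigma>\<^sup>2)) = 1 / sqrt ((2 * pi) ^ CARD('n) * (\<sigma>\<^sup>2) ^ CARD('n))"
    by (simp add: power_divide real_sqrt_power[symmetric] power_mult_distrib)
  finally show ?thesis
    unfolding multi_normal_density_def inv det
    by (simp add: scaleR_matrix_vector_assoc[symmetric] field_simps)
qed

lemma inner_matrix_vector_mult_Gram: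
  fixes X :: "real^'k^'n"
  shows "(X *v v) \<bullet> (X *v w) = v \<bullet> ((transpose X ** X) *v w)"
proof -
  have "(X *v v) \<bullet> (X *v w) = ((X *v w) v* X) \<bullet> v"
    by (metis dot_lmul_matrix inner_commute)
  also have "\<dots> = v \<bullet> ((X *v w) v* X)"
    by (rule inner_commute)
  finally show ?thesis
    by (simp add: matrix_vector_mul_assoc[symmetric])
qed

text \<open>
  A kernel vector \<^term>\<open>x\<close> of the Gram matrix satisfies \<open>(X *v x) \<bullet> (X *v x) = 0\<close>, so it is
  killed by the injective matrix \<^term>\<open>X\<close>.
\<close>

lemma gram_matrix_inverse:
  fixes X :: "real^'k^'n"
  assumes "rank X = CARD('k)"
  shows "transpose X ** X ** matrix_inv (transpose X ** X) = mat 1"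
    and "matrix_inv (transpose X ** X) ** (transpose X ** X) = mat 1"
proof -
  have inj: "inj ((*v) X)"
    using assms by (simp add: full_rank_injective)
  have "x = 0" if "(transpose X ** X) *v x = 0" for x
  proof -
    have "(X *v x) \<bullet> (X *v x) = x \<bullet> ((transpose X ** X) *v x)"
      by (rule inner_matrix_vector_mult_Gram)
    then have "X *v x = X *v 0"
      using that by simp
    then show ?thesis
      by (rule injD[OF inj])
  qed
  then obtain B where "B ** (transpose X ** X) = mat 1"
    using matrix_left_invertible_ker by blast
  then have "transpose X ** X ** B = mat 1"
    by (simp add: matrix_left_right_inverse)
  moreover have "B = matrix_inv (transpose X ** X)"
    by (rule matrix_inv_eqI[symmetric]) fact
  ultimately show "transpose X ** X ** matrix_inv (transpose X ** X) = mat 1"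
    by simp
  then show "matrix_inv (transpose X ** X) ** (transpose X ** X) = mat 1"
    by (simp add: matrix_left_right_inverse)
qed

text \<open>
  The \<^term>\<open>i\<close>-th row, as a column vector, of the matrix
  \<open>matrix_inv (transpose X ** X) ** transpose X\<close> that maps the sample to the estimate.
\<close>

definition LS_weights :: "real^'k^'n \<Rightarrow> 'k \<Rightarrow> real^'n" where
  "LS_weights X i = X *v (axis i 1 v* matrix_inv (transpose X ** X))"

lemma theta_LS_nth_eq_inner: "theta_LS X y $ i = LS_weights X i \<bullet> y"
proof -
  have "theta_LS X y $ i = axis i 1 \<bullet> (matrix_inv (transpose X ** X) *v (transpose X *v y))"
    by (simp add: theta_LS_def inner_axis_axis inner_axis' )
  also have "\<dots> = (axis i 1 v* matrix_inv (transpose X ** X)) \<bullet> (transpose X *v y)"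
    by (rule dot_lmul_matrix[symmetric])
  also have "\<dots> = LS_weights X i \<bullet> y"
    by (simp add: LS_weights_def inner_commute dot_lmul_matrix)
  finally show ?thesis .
qed

lemma theta_LS_linear_model:
  fixes X :: "real^'k^'n"
  assumes "rank X = CARD('k)"
  shows "theta_LS X (X *v \<theta> + u) $ i = \<theta> $ i + LS_weights X i \<bullet> u"
proof -
  have "LS_weights X i \<bullet> (X *v \<theta>) = theta_LS X (X *v \<theta>) $ i"
    by (simp only: theta_LS_nth_eq_inner)
  also have "theta_LS X (X *v \<theta>) = \<theta>"
    unfolding theta_LS_def by (simp only: matrix_vector_mul_assoc gram_matrix_inverse[OF assms]
      matrix_mul_assoc[symmetric] matrix_vector_mul_lid)
  finally show ?thesis
    by (simp only: theta_LS_nth_eq_inner inner_add_right)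
qed

text \<open>
  The standard deviation of \<open>LS_weights X i \<bullet> u\<close> is \<open>\<sigma> * norm (LS_weights X i)\<close>, and its square
  is \<open>\<sigma>\<^sup>2\<close> times the \<^term>\<open>i\<close>-th diagonal entry of the inverse Gram matrix: in the squared norm,
  one of the two inverses cancels against the Gram matrix. The factor \<^term>\<open>sqrt (real CARD('n))\<close>
  comes from the normalisation of the Gram matrix by the sample size in \<^const>\<open>xi\<close>.
\<close>

lemma xi_eq_norm_LS_weights:
  fixes X :: "real^'k^'n"
  assumes "rank X = CARD('k)"
  shows "xi X i = sqrt (real CARD('n)) * norm (LS_weights X i)"
proof -
  define A where "A = transpose X ** X"
  define w where "w = axis i 1 v* matrix_inv A"
  note inv = gram_matrix_inverse[OF assms, folded A_def]
  have Ax: "LS_weights X i = X *v w"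
    by (simp add: LS_weights_def w_def A_def)
  have "(X *v w) \<bullet> (X *v w) = (w v* A) \<bullet> w"
    by (simp only: inner_matrix_vector_mult_Gram A_def dot_lmul_matrix)
  also have "w v* A = axis i 1"
    by (simp add: w_def vector_matrix_mul_assoc inv)
  also have "axis i 1 \<bullet> w = matrix_inv A $ i $ i"
    by (simp add: w_def inner_axis' vector_matrix_mult_def)
       (simp add: axis_def if_distrib if_distribR cong: if_cong)
  finally have "matrix_inv A $ i $ i = (norm (LS_weights X i))\<^sup>2"
    by (simp add: Ax power2_norm_eq_inner)
  moreover have "matrix_inv ((1 / real CARD('n)) *\<^sub>R A) = real CARD('n) *\<^sub>R matrix_inv A"
    using matrix_inv_scaleR[OF inv(1), of "1 / real CARD('n)"] by simp
  ultimately show ?thesis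
    by (simp add: xi_def A_def[symmetric] real_sqrt_mult)
qed

text \<open>
  Least squares recovers every parameter from noiseless data, also the unit vector
  \<^term>\<open>axis i 1\<close>; zero weights could not.
\<close>

lemma LS_weights_nonzero:
  fixes X :: "real^'k^'n"
  assumes "rank X = CARD('k)"
  shows "LS_weights X i \<noteq> 0"
proof
  assume "LS_weights X i = 0"
  then have "theta_LS X (X *v axis i 1 + 0) $ i = 0"
    by (simp add: theta_LS_nth_eq_inner)
  then show False
    unfolding theta_LS_linear_model[OF assms] by simp
qed

section \<open>Collapsing an interval under a normal law\<close>

lemma (in prob_space) prob_normal_le:
  assumes c: "0 < c" and W: "distributed M lborel W (normal_density 0 c)"
  shows "prob {\<omega> \<in> space M. W \<omega> \<le> w} = std_normal_cdf (w / c)"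
proof -
  have Z: "distributed M lborel (\<lambda>\<omega>. (W \<omega> - 0) / c) std_normal_density"
    using W normal_standard_normal_convert[OF c] by blast
  have "std_normal_cdf (w / c) = measure (distr M lborel (\<lambda>\<omega>. (W \<omega> - 0) / c)) {..w / c}"
    using Z by (simp add: cdf_def distributed_def)
  also have "\<dots> = prob ((\<lambda>\<omega>. (W \<omega> - 0) / c) -` {..w / c} \<inter> space M)"
    using Z by (intro measure_distr) (auto simp: distributed_def)
  also have "(\<lambda>\<omega>. (W \<omega> - 0) / c) -` {..w / c} \<inter> space M = {\<omega> \<in> space M. W \<omega> \<le> w}"
    using c by (auto simp: divide_le_cancel)
  finally show ?thesis ..
qed

text \<open>A law with a density has no atoms, so strict and weak inequality have the same probability.\<close>

lemma (in prob_space) prob_normal_less: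
  assumes c: "0 < c" and W: "distributed M lborel W (normal_density 0 c)"
  shows "prob {\<omega> \<in> space M. W \<omega> < w} = std_normal_cdf (w / c)"
proof -
  have [measurable]: "W \<in> borel_measurable M"
    using W by (simp add: distributed_def)
  have "AE x in lborel. ennreal (normal_density 0 c x) * indicator {w} x = 0"
    using AE_lborel_singleton[of w] by eventually_elim auto
  then have "(\<integral>\<^sup>+x. ennreal (normal_density 0 c x) * indicator {w} x \<partial>lborel) = 0"
    by (simp add: nn_integral_0_iff_AE)
  then have "emeasure M (W -` {w} \<inter> space M) = 0"
    by (simp add: distributed_emeasure[OF W])
  then have "AE \<omega> in M. W \<omega> \<noteq> w"
    by (intro AE_I'[of "W -` {w} \<inter> space M"]) (auto simp: null_sets_def)
  then have "prob {\<omega> \<in> space M. W \<omega> < w} = prob {\<omega> \<in> space M. W \<omega> \<le> w}"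
    by (intro measure_eq_AE) auto
  then show ?thesis
    using prob_normal_le[OF c W] by simp
qed

text \<open>
  Thresholding seen from the centred and scaled error: for \<open>z = 0\<close> this is the hard-thresholding
  function itself.
\<close>

definition collapse :: "real \<Rightarrow> real \<Rightarrow> real \<Rightarrow> real" where
  "collapse z t w = (if \<bar>w - z\<bar> > t then w else z)"

lemma borel_measurable_collapse [measurable]: "collapse z t \<in> borel_measurable borel"
  unfolding collapse_def by measurable

text \<open>
  The map \<^term>\<open>collapse z t\<close> moves only points within \<^term>\<open>t\<close> of \<^term>\<open>z\<close>. For \<^term>\<open>x\<close> outside
  this interval, moving those points does not change on which side of \<^term>\<open>x\<close> they lie. For
  \<^term>\<open>x\<close> inside, the whole interval lands at or below \<^term>\<open>x\<close> if \<open>z \<le> x\<close> and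
  above it otherwise.
\<close>

lemma (in prob_space) cdf_collapse_normal:
  assumes c: "0 < c" and W: "distributed M lborel W (normal_density 0 c)"
  shows "cdf (distr M borel (\<lambda>\<omega>. collapse z t (W \<omega>))) x
       = std_normal_cdf (x / c) * of_bool (\<bar>x - z\<bar> > t)
       + std_normal_cdf ((z + t) / c) * of_bool (0 \<le> x - z \<and> x - z \<le> t)
       + std_normal_cdf ((z - t) / c) * of_bool (- t \<le> x - z \<and> x - z < 0)"
proof -
  have [measurable]: "W \<in> borel_measurable M"
    using W by (simp add: distributed_def)
  have "cdf (distr M borel (\<lambda>\<omega>. collapse z t (W \<omega>))) x
      = prob {\<omega> \<in> space M. collapse z t (W \<omega>) \<le> x}"
    by (simp add: cdf_def measure_distr vimage_def Int_def conj_commute)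
  also have "\<dots> = (if \<bar>x - z\<bar> > t then prob {\<omega> \<in> space M. W \<omega> \<le> x}
      else if 0 \<le> x - z then prob {\<omega> \<in> space M. W \<omega> \<le> z + t}
      else prob {\<omega> \<in> space M. W \<omega> < z - t})"
    by (auto simp: collapse_def intro!: arg_cong[where f = prob])
  finally show ?thesis
    by (auto simp: prob_normal_le[OF c W] prob_normal_less[OF c W])
qed

text \<open>
  The closed interval of radius \<^term>\<open>t\<close> gives the atom at \<^term>\<open>z\<close>, and its complement, where the map
  is the identity, gives the part with a density.
\<close>

lemma (in prob_space) emeasure_collapse_normal:
  assumes c: "0 < c" and W: "distributed M lborel W (normal_density 0 c)" and t: "0 \<le> t"
    and A [measurable]: "A \<in> sets borel"
  shows "emeasure (distr M borel (\<lambda>\<omega>. collapse z t (W \<omega>))) A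
       = ennreal (std_normal_cdf ((z + t) / c) - std_normal_cdf ((z - t) / c)) * emeasure (return borel z) A
       + emeasure (density lborel (\<lambda>x. ennreal (normal_density 0 c x * of_bool (\<bar>x - z\<bar> > t)))) A"
proof -
  have [measurable]: "W \<in> borel_measurable M"
    using W by (simp add: distributed_def)
  have "prob {\<omega> \<in> space M. \<bar>W \<omega> - z\<bar> \<le> t}
      = prob ({\<omega> \<in> space M. W \<omega> \<le> z + t} - {\<omega> \<in> space M. W \<omega> < z - t})"
    by (rule arg_cong[where f = prob]) auto
  also have "\<dots> = std_normal_cdf ((z + t) / c) - std_normal_cdf ((z - t) / c)"
    using t by (subst finite_measure_Diff) (auto simp: prob_normal_le[OF c W] prob_normal_less[OF c W])
  finally have mid: "emeasure M {\<omega> \<in> space M. \<bar>W \<omega> - z\<bar> \<le> t}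
      = ennreal (std_normal_cdf ((z + t) / c) - std_normal_cdf ((z - t) / c))"
    by (simp add: emeasure_eq_measure)
  have "emeasure (distr M borel (\<lambda>\<omega>. collapse z t (W \<omega>))) A
      = emeasure M ({\<omega> \<in> space M. \<bar>W \<omega> - z\<bar> \<le> t \<and> z \<in> A}
                  \<union> (W -` (A \<inter> {x. \<bar>x - z\<bar> > t}) \<inter> space M))"
    by (subst emeasure_distr) (auto simp: collapse_def split: if_splits intro!: arg_cong[where f = "emeasure M"])
  also have "\<dots> = emeasure M {\<omega> \<in> space M. \<bar>W \<omega> - z\<bar> \<le> t \<and> z \<in> A}
      + emeasure M (W -` (A \<inter> {x. \<bar>x - z\<bar> > t}) \<inter> space M)"
    by (rule plus_emeasure[symmetric]) auto
  also have "emeasure M {\<omega> \<in> space M. \<bar>W \<omega> - z\<bar> \<le> t \<and> z \<in> A}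
      = ennreal (std_normal_cdf ((z + t) / c) - std_normal_cdf ((z - t) / c)) * emeasure (return borel z) A"
    using mid by (cases "z \<in> A") auto
  also have "emeasure M (W -` (A \<inter> {x. \<bar>x - z\<bar> > t}) \<inter> space M)
      = emeasure (density lborel (\<lambda>x. ennreal (normal_density 0 c x * of_bool (\<bar>x - z\<bar> > t)))) A"
    by (subst distributed_emeasure[OF W])
       (auto simp: emeasure_density indicator_def intro!: nn_integral_cong)
  finally show ?thesis .
qed

section \<open>The law of the hard-thresholding estimator\<close>

lemma normal_density_0_eq_std:
  assumes "0 < c"
  shows "normal_density 0 c x = std_normal_density (x / c) / c"
  using assms by (simp add: normal_density_def real_sqrt_mult power_divide)

theorem proposition19:
  fixes X :: "real^'k^'n" and \<theta> :: "real^'k" and \<sigma> \<eta> \<alpha> :: real and i :: 'k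
    and M :: "'a measure" and u Y :: "'a \<Rightarrow> real^'n"
  defines "n \<equiv> real CARD('n)"
    and "H \<equiv> distr M borel (\<lambda>\<omega>. inverse \<sigma> * \<alpha> * (theta_H X \<sigma> \<eta> i (Y \<omega>) - \<theta> $ i))"
  assumes "rank X = CARD('k)"
    and "\<sigma> > 0" and "\<eta> > 0" and "\<alpha> > 0"
    and "prob_space M"
    and "distributed M lborel u (\<lambda>y. ennreal (multi_normal_density 0 (\<sigma>\<^sup>2 *\<^sub>R mat 1) y))"
    and "\<And>\<omega>. Y \<omega> = X *v \<theta> + u \<omega>"
  shows "(\<forall>x. cdf H x =
            std_normal_cdf (sqrt n * x / (\<alpha> * xi X i))
              * of_bool (\<bar>x / \<alpha> + \<theta> $ i / \<sigma>\<bar> > xi X i * \<eta>)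
          + std_normal_cdf (sqrt n * (- (\<theta> $ i) / (\<sigma> * xi X i) + \<eta>))
              * of_bool (0 \<le> x / \<alpha> + \<theta> $ i / \<sigma> \<and> x / \<alpha> + \<theta> $ i / \<sigma> \<le> xi X i * \<eta>)
          + std_normal_cdf (sqrt n * (- (\<theta> $ i) / (\<sigma> * xi X i) - \<eta>))
              * of_bool (- (xi X i * \<eta>) \<le> x / \<alpha> + \<theta> $ i / \<sigma> \<and> x / \<alpha> + \<theta> $ i / \<sigma> < 0))
       \<and> (\<forall>A \<in> sets borel. emeasure H A =
            ennreal (std_normal_cdf (sqrt n * (- (\<theta> $ i) / (\<sigma> * xi X i) + \<eta>))
                     - std_normal_cdf (sqrt n * (- (\<theta> $ i) / (\<sigma> * xi X i) - \<eta>)))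
              * emeasure (return borel (- \<alpha> * \<theta> $ i / \<sigma>)) A
          + emeasure (density lborel (\<lambda>x. ennreal
              (sqrt n / (\<alpha> * xi X i) * std_normal_density (sqrt n * x / (\<alpha> * xi X i))
                * of_bool (\<bar>x / \<alpha> + \<theta> $ i / \<sigma>\<bar> > xi X i * \<eta>)))) A)"
proof -
  note rank = assms(3) and pos = assms(4-6) and M = assms(7) and u = assms(8) and Y = assms(9)
  interpret prob_space M by (rule M)
  define a where "a = LS_weights X i"
  \<comment> \<open>Standard deviation of the scaled error \<open>W\<close>, and centre and radius of the interval that
      thresholding collapses.\<close>
  define c where "c = \<alpha> * xi X i / sqrt n"
  define z where "z = - \<alpha> * \<theta> $ i / \<sigma>"
  define t where "t = \<alpha> * (xi X i * \<eta>)"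
  define W where "W \<omega> = (\<alpha> / \<sigma>) * (a \<bullet> u \<omega>)" for \<omega>
  have n: "0 < n" by (simp add: n_def)
  have a: "a \<noteq> 0" by (simp add: a_def LS_weights_nonzero[OF rank])
  have xi: "xi X i = sqrt n * norm a"
    by (simp add: xi_eq_norm_LS_weights[OF rank] n_def a_def)
  have xi_pos: "0 < xi X i" using n a by (simp add: xi)
  have c: "0 < c" and t: "0 \<le> t"
    using n pos xi_pos by (simp_all add: c_def t_def)
  have "distributed M lborel (\<lambda>\<omega>. a \<bullet> u \<omega>) (normal_density 0 (\<sigma> * norm a))"
    using normal_inner[OF pos(1) a] u by (simp add: multi_normal_density_isotropic pos(1))
  then have "distributed M lborel (\<lambda>\<omega>. 0 + (\<alpha> / \<sigma>) * (a \<bullet> u \<omega>))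
      (normal_density (0 + (\<alpha> / \<sigma>) * 0) (\<bar>\<alpha> / \<sigma>\<bar> * (\<sigma> * norm a)))"
    by (rule normal_density_affine) (use pos a in auto)
  moreover have "\<bar>\<alpha> / \<sigma>\<bar> * (\<sigma> * norm a) = c"
    using pos n by (simp add: c_def xi)
  ultimately have W: "distributed M lborel W (normal_density 0 c)"
    by (simp add: W_def[abs_def])
  have "inverse \<sigma> * \<alpha> * (theta_H X \<sigma> \<eta> i (Y \<omega>) - \<theta> $ i) = collapse z t (W \<omega>)" for \<omega>
  proof -
    have LS: "theta_LS X (Y \<omega>) $ i = \<theta> $ i + a \<bullet> u \<omega>"
      by (simp add: Y theta_LS_linear_model[OF rank] a_def)
    have Wz: "W \<omega> - z = (\<alpha> / \<sigma>) * (\<theta> $ i + a \<bullet> u \<omega>)"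
      by (simp add: W_def z_def algebra_simps)
    have "\<bar>W \<omega> - z\<bar> > t \<longleftrightarrow> \<bar>\<theta> $ i + a \<bullet> u \<omega>\<bar> > \<sigma> * xi X i * \<eta>"
      unfolding Wz t_def abs_mult using pos by (simp add: field_simps)
    then show ?thesis
      by (simp add: theta_H_def LS collapse_def W_def z_def divide_inverse)
  qed
  then have H: "H = distr M borel (\<lambda>\<omega>. collapse z t (W \<omega>))"
    by (simp add: H_def)
  have scale: "x - z = \<alpha> * (x / \<alpha> + \<theta> $ i / \<sigma>)" for x
    using pos by (simp add: z_def field_simps)
  \<comment> \<open>By \<open>scale\<close>, positions relative to the interval are \<^term>\<open>\<alpha>\<close> times those relative to
      \<open>[- xi X i * \<eta>, xi X i * \<eta>]\<close>.\<close>
  have conds: "\<bar>x - z\<bar> > t \<longleftrightarrow> \<bar>x / \<alpha> + \<theta> $ i / \<sigma>\<bar> > xi X i * \<eta>"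
      "0 \<le> x - z \<longleftrightarrow> 0 \<le> x / \<alpha> + \<theta> $ i / \<sigma>"
      "x - z < 0 \<longleftrightarrow> x / \<alpha> + \<theta> $ i / \<sigma> < 0"
      "x - z \<le> t \<longleftrightarrow> x / \<alpha> + \<theta> $ i / \<sigma> \<le> xi X i * \<eta>"
      "- t \<le> x - z \<longleftrightarrow> - (xi X i * \<eta>) \<le> x / \<alpha> + \<theta> $ i / \<sigma>" for x
    using pos mult_le_cancel_left_pos[of \<alpha> "- (xi X i * \<eta>)"] unfolding scale t_def abs_mult
    by (simp_all add: zero_le_mult_iff mult_less_0_iff)
  have args: "x / c = sqrt n * x / (\<alpha> * xi X i)"
      "(z + t) / c = sqrt n * (- (\<theta> $ i) / (\<sigma> * xi X i) + \<eta>)"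
      "(z - t) / c = sqrt n * (- (\<theta> $ i) / (\<sigma> * xi X i) - \<eta>)" for x
    using pos n xi_pos by (simp_all add: c_def z_def t_def field_simps)
  have dens: "normal_density 0 c x
      = sqrt n / (\<alpha> * xi X i) * std_normal_density (sqrt n * x / (\<alpha> * xi X i))" for x
    unfolding normal_density_0_eq_std[OF c] args by (simp add: c_def)
  show ?thesis
    using cdf_collapse_normal[OF c W, of z t, unfolded conds args(2,3), unfolded args(1)]
      emeasure_collapse_normal[OF c W t, of _ z, unfolded conds args(2,3), unfolded dens]
    unfolding H z_def[symmetric] by (intro conjI allI ballI)
qed

end
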